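(* Assume $|\mathcal{G}|>1$. In the two-stage market with a day-ahead MPM policy, the total generator profit $\sum_{j\in\mathcal{G}}\pi_j$ at the (Stackelberg-)Nash equilibrium is always below the total generator profit at the competitive equilibrium.
   Context: Market: $\mathcal{G}$ (generators) and $\mathcal{L}$ (loads) are finite nonempty sets. Generator $j$ has cost $\frac{c_j}{2}g_j^2$, $c_j>0$, for total dispatch $g_j=g_j^d+g_j^r$ (day-ahead plus real-time dispatch, real numbers). Load $l$ has fixed inelastic demand $d_l>0$ split as $d_l=d_l^d+d_l^r$ with $d_l^d,d_l^r\in\mathbb{R}$; $d:=\sum_l d_l$, $d^d:=\sum_ld_l^d$, $d^r:=\sum_ld_l^r=d-d^d$. Day-ahead MPM (market power mitigation) policy: in the day-ahead market, generator bids are replaced by true costs, so $g_j^d=c_j^{-1}\lambda^d$ for all $j$, and by day-ahead power balance $\lambda^d=d^d/\sum_{k\in\mathcal{G}}c_k^{-1}$. Real-time market: with fixed slope $b^r>0$, generator $j$ bids $\beta_j^r\in\mathbb{R}$, meaning $g_j^r=b^r\lambda^r-\beta_j^r$; the market clears when $\sum_j(b^r\lambda^r-\beta_j^r)=d^r$. Profit of generator $j$: $\pi_j=\lambda^rg_j^r+\lambda^dg_j^d-\frac{c_j}{2}(g_j^d+g_j^r)^2$. Payment of load $l$: $\rho_l=\lambda^dd_l^d+\lambda^r(d_l-d_l^d)$. Competitive equilibrium (price-taking participants): given $\lambda^r$ and the day-ahead outcome, each generator chooses $\beta_j^r$ to maximize $\pi_j$; given $(\lambda^d,\lambda^r)$,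 each load chooses $d_l^d$ to minimize $\rho_l$ (with $d_l^r=d_l-d_l^d$); the day-ahead dispatch and price follow the policy rule and the real-time market clears. It satisfies $g_j^d=\frac{c_j^{-1}}{\sum_kc_k^{-1}}d$, $g_j^r=0$, $d^d=d$, $d^r=0$, $\lambda^d=\lambda^r=\frac{d}{\sum_kc_k^{-1}}$. Stackelberg-Nash equilibrium (price-anticipating participants): generators are followers: given the day-ahead outcome, they simultaneously choose $\beta_j^r$, each maximizing $\pi_j$ given the others' bids and anticipating the effect of its own bid on the real-time clearing price $\lambda^r$. Loads are leaders: they simultaneously choose $d_l^d$, each minimizing $\rho_l$ given the other loads' choices and anticipating $\lambda^d$ from the policy rule and $\lambda^r$ from the resulting real-time subgame equilibrium. For $|\mathcal{G}|>1$ it exists uniquely; with $C_j:=\frac{1}{b^r(|\mathcal{G}|-1)}+c_j$ it satisfies $$g_j^d=\left(1-\frac{\sum_kC_k^{-1}}{(|\mathcal{L}|+1)\sum_kc_k^{-1}}\right)\frac{c_j^{-1}}{\sum_kc_k^{-1}}d,\quad g_j^r=\frac{C_j^{-1}}{|\mathcal{L}|+1}\frac{d}{\sum_kc_k^{-1}},$$ $$\lambda^d=\left(1-\frac{\sum_kC_k^{-1}}{(|\mathcal{L}|+1)\sum_kc_k^{-1}}\right)\frac{d}{\sum_kc_k^{-1}},\quad \lambda^r=\lambda^d+\frac{1}{|\mathcal{L}|+1}\frac{d}{\sum_kc_k^{-1}}.$$ *)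

theory Defs
  imports Complex_Main "HOL-Library.Cardinality"
begin

text \<open>
  Generators are the elements of a finite type \<open>'g\<close>, loads those of a finite type \<open>'l\<close>.
  Throughout, \<open>c\<close> are the generator cost coefficients, \<open>d\<close> the inelastic demands, \<open>b\<close> the
  real-time bid slope, \<open>dd\<close> the day-ahead demands, \<open>\<beta>\<close> the real-time bids, \<open>lr\<close> the real-time price.
\<close>

definition da_price :: "('g::finite \<Rightarrow> real) \<Rightarrow> ('l::finite \<Rightarrow> real) \<Rightarrow> real" where
  "da_price c dd = (\<Sum>l\<in>UNIV. dd l) / (\<Sum>k\<in>UNIV. inverse (c k))"

definition da_dispatch :: "('g::finite \<Rightarrow> real) \<Rightarrow> ('l::finite \<Rightarrow> real) \<Rightarrow> 'g \<Rightarrow> real" where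
  "da_dispatch c dd j = inverse (c j) * da_price c dd"

definition rt_demand :: "('l::finite \<Rightarrow> real) \<Rightarrow> ('l \<Rightarrow> real) \<Rightarrow> real" where
  "rt_demand d dd = (\<Sum>l\<in>UNIV. d l - dd l)"

definition rt_dispatch :: "real \<Rightarrow> real \<Rightarrow> real \<Rightarrow> real" where
  "rt_dispatch b lr bid = b * lr - bid"

definition rt_clears ::
  "('l::finite \<Rightarrow> real) \<Rightarrow> real \<Rightarrow> ('l \<Rightarrow> real) \<Rightarrow> ('g::finite \<Rightarrow> real) \<Rightarrow> real \<Rightarrow> bool" where
  "rt_clears d b dd \<beta> lr \<longleftrightarrow> (\<Sum>j\<in>UNIV. rt_dispatch b lr (\<beta> j)) = rt_demand d dd"

text \<open>The clearing price as a function of the bids; see \<open>rt_clears_iff\<close> below.\<close>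

definition rt_price ::
  "('l::finite \<Rightarrow> real) \<Rightarrow> real \<Rightarrow> ('l \<Rightarrow> real) \<Rightarrow> ('g::finite \<Rightarrow> real) \<Rightarrow> real" where
  "rt_price d b dd \<beta> = (rt_demand d dd + (\<Sum>j\<in>UNIV. \<beta> j)) / (real CARD('g) * b)"

definition gen_profit ::
  "('g::finite \<Rightarrow> real) \<Rightarrow> real \<Rightarrow> ('l::finite \<Rightarrow> real) \<Rightarrow> real \<Rightarrow> 'g \<Rightarrow> real \<Rightarrow> real" where
  "gen_profit c b dd lr j bid =
     lr * rt_dispatch b lr bid + da_price c dd * da_dispatch c dd j
     - c j / 2 * (da_dispatch c dd j + rt_dispatch b lr bid)\<^sup>2"

definition total_gen_profit ::
  "('g::finite \<Rightarrow> real) \<Rightarrow> real \<Rightarrow> ('l::finite \<Rightarrow> real) \<Rightarrow> real \<Rightarrow> ('g \<Rightarrow> real) \<Rightarrow> real" where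
  "total_gen_profit c b dd lr \<beta> = (\<Sum>j\<in>UNIV. gen_profit c b dd lr j (\<beta> j))"

definition load_payment :: "real \<Rightarrow> real \<Rightarrow> real \<Rightarrow> real \<Rightarrow> real" where
  "load_payment ld lr dl x = ld * x + lr * (dl - x)"

text \<open>Price-taking participants: all prices and the day-ahead outcome stay fixed under a
  participant's own deviation.\<close>

definition competitive_equilibrium ::
  "('g::finite \<Rightarrow> real) \<Rightarrow> ('l::finite \<Rightarrow> real) \<Rightarrow> real \<Rightarrow> ('l \<Rightarrow> real) \<Rightarrow> ('g \<Rightarrow> real) \<Rightarrow> real \<Rightarrow> bool"
where
  "competitive_equilibrium c d b dd \<beta> lr \<longleftrightarrow>
     rt_clears d b dd \<beta> lr \<and>
     (\<forall>j x. gen_profit c b dd lr j x \<le> gen_profit c b dd lr j (\<beta> j)) \<and>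
     (\<forall>l x. load_payment (da_price c dd) lr (d l) (dd l) \<le> load_payment (da_price c dd) lr (d l) x)"

text \<open>Real-time subgame after the day-ahead demands \<open>dd\<close>: a unilateral deviation in the bid
  also moves the clearing price.\<close>

definition rt_nash_equilibrium ::
  "('g::finite \<Rightarrow> real) \<Rightarrow> ('l::finite \<Rightarrow> real) \<Rightarrow> real \<Rightarrow> ('l \<Rightarrow> real) \<Rightarrow> ('g \<Rightarrow> real) \<Rightarrow> bool"
where
  "rt_nash_equilibrium c d b dd \<beta> \<longleftrightarrow>
     (\<forall>j x. gen_profit c b dd (rt_price d b dd (\<beta>(j := x))) j x
            \<le> gen_profit c b dd (rt_price d b dd \<beta>) j (\<beta> j))"

text \<open>Generators' strategies are given jointly by \<open>\<sigma>\<close>, which maps every profile of day-ahead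
  demands, on or off the equilibrium path, to a profile of real-time bids.  A deviating load
  anticipates \<open>da_price\<close> and the real-time price induced by \<open>\<sigma>\<close> at the deviated profile.\<close>

definition stackelberg_nash_equilibrium ::
  "('g::finite \<Rightarrow> real) \<Rightarrow> ('l::finite \<Rightarrow> real) \<Rightarrow> real \<Rightarrow>
   ('l \<Rightarrow> real) \<Rightarrow> (('l \<Rightarrow> real) \<Rightarrow> ('g \<Rightarrow> real)) \<Rightarrow> bool"
where
  "stackelberg_nash_equilibrium c d b dd \<sigma> \<longleftrightarrow>
     (\<forall>dd'. rt_nash_equilibrium c d b dd' (\<sigma> dd')) \<and>
     (\<forall>l x. load_payment (da_price c dd) (rt_price d b dd (\<sigma> dd)) (d l) (dd l)
            \<le> load_payment (da_price c (dd(l := x)))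
                 (rt_price d b (dd(l := x)) (\<sigma> (dd(l := x)))) (d l) x)"

lemma da_price_iff:
  fixes c :: "'g::finite \<Rightarrow> real" and dd :: "'l::finite \<Rightarrow> real"
  assumes "\<And>j. c j > 0"
  shows "(\<Sum>j\<in>UNIV. inverse (c j) * ld) = (\<Sum>l\<in>UNIV. dd l) \<longleftrightarrow> ld = da_price c dd"
proof -
  have "(\<Sum>j\<in>UNIV. inverse (c j)) > 0"
    by (rule sum_pos) (simp_all add: assms)
  moreover have "(\<Sum>j\<in>UNIV. inverse (c j) * ld) = ld * (\<Sum>j\<in>UNIV. inverse (c j))"
    by (simp add: sum_distrib_left mult.commute)
  ultimately show ?thesis
    unfolding da_price_def by (metis less_irrefl nonzero_eq_divide_eq)
qed

lemma rt_clears_iff: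
  fixes \<beta> :: "'g::finite \<Rightarrow> real" and d dd :: "'l::finite \<Rightarrow> real"
  assumes "b > 0"
  shows "rt_clears d b dd \<beta> lr \<longleftrightarrow> lr = rt_price d b dd \<beta>"
  using assms
  by (auto simp: rt_clears_def rt_price_def rt_dispatch_def sum_subtractf field_simps)

end

theory Submission
  imports Defs
begin

text \<open>
  Write \<open>S = \<Sum> 1/c\<^sub>k\<close>, \<open>T = \<Sum> 1/C\<^sub>k\<close>, \<open>D = \<Sum> d\<^sub>l\<close> and \<open>E = D/S\<close>. Every deviation payoff is
  quadratic in the deviation, so equilibria satisfy first-order conditions. Price takers are
  indifferent only when both prices equal \<open>E\<close>, which yields the total profit \<open>S E\<^sup>2/2\<close>. In the
  subgame, generator \<open>j\<close> supplies \<open>u/C\<^sub>j\<close>, where \<open>u\<close> is the excess of the real-time over the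
  day-ahead price; summing the first-order conditions of the loads gives \<open>u = E/(L+1)\<close> and
  \<open>\<lambda>\<^sup>d = E - T u/S\<close>, where \<open>L\<close> is the number of loads. The total profit
  \<open>S (\<lambda>\<^sup>d)\<^sup>2/2 + \<Sum> (u\<^sup>2/C\<^sub>j - c\<^sub>j u\<^sup>2/(2 C\<^sub>j\<^sup>2))\<close> is then smaller, because
  \<open>0 < T < S\<close> and \<open>L \<ge> 1\<close>.
\<close>

text \<open>First-order condition at \<open>t = 0\<close> without derivatives: were \<open>A\<close>
  nonzero, a small step in its direction would let the linear term outweigh the quadratic
  one.\<close>

lemma linear_coeff_zero_if_nonpos:
  fixes A B :: real
  assumes "\<And>t. A * t + B * t\<^sup>2 \<le> 0"
  shows "A = 0"
proof (rule ccontr)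
  assume "A \<noteq> 0"
  \<comment> \<open>The step is \<open>A / m\<close>; its value has the sign of
    \<open>m + B\<close>, so any positive \<open>m\<close> above \<open>- B\<close> works.\<close>
  define m where "m = \<bar>B\<bar> + 1"
  have m: "m > 0" "m + B > 0"
    by (auto simp: m_def)
  have "A * (A / m) + B * (A / m)\<^sup>2 = A\<^sup>2 * (m + B) / m\<^sup>2"
    using m by (simp add: field_simps power2_eq_square)
  moreover have "A\<^sup>2 * (m + B) / m\<^sup>2 > 0"
    using m \<open>A \<noteq> 0\<close> by simp
  ultimately show False
    using assms[of "A / m"] by linarith
qed

lemma sum_inverse_pos:
  fixes c :: "'g::finite \<Rightarrow> real"
  assumes "\<And>j. c j > 0"
  shows "(\<Sum>j\<in>UNIV. inverse (c j)) > 0"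
  by (rule sum_pos) (simp_all add: assms)

lemma sum_fun_upd_UNIV:
  fixes f :: "'a::finite \<Rightarrow> real"
  shows "(\<Sum>i\<in>UNIV. (f(j := x)) i) = (\<Sum>i\<in>UNIV. f i) + (x - f j)"
  by (simp add: sum.remove[of UNIV j])

section \<open>Competitive equilibrium\<close>

lemma competitive_dispatch:
  fixes c :: "'g::finite \<Rightarrow> real" and d :: "'l::finite \<Rightarrow> real"
  assumes "c j > 0" "competitive_equilibrium c d b dd \<beta> lr"
  shows "da_dispatch c dd j + rt_dispatch b lr (\<beta> j) = lr / c j"
proof -
  let ?g = "da_dispatch c dd j + rt_dispatch b lr (\<beta> j)"
  \<comment> \<open>At a fixed price, lowering the bid by \<open>t\<close> raises the dispatch by
    \<open>t\<close>; the linear coefficient is price minus marginal cost.\<close>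
  have "(lr - c j * ?g) * t + (- c j / 2) * t\<^sup>2 \<le> 0" for t
  proof -
    have "(lr - c j * ?g) * t + (- c j / 2) * t\<^sup>2
        = gen_profit c b dd lr j (\<beta> j - t) - gen_profit c b dd lr j (\<beta> j)"
      by (simp add: gen_profit_def rt_dispatch_def algebra_simps power2_eq_square)
    then show ?thesis
      using assms(2) by (simp add: competitive_equilibrium_def)
  qed
  then have "lr - c j * ?g = 0"
    by (rule linear_coeff_zero_if_nonpos)
  then show ?thesis
    using assms(1) by (simp add: field_simps)
qed

text \<open>The payment is affine in the day-ahead demand, which ranges over all reals, so a minimum
  forces slope zero. One load suffices, and types are nonempty.\<close>

lemma competitive_prices_eq:
  fixes c :: "'g::finite \<Rightarrow> real" and d :: "'l::finite \<Rightarrow> real"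
  assumes "competitive_equilibrium c d b dd \<beta> lr"
  shows "lr = da_price c dd"
proof -
  fix l :: 'l
  have "(lr - da_price c dd) * t + 0 * t\<^sup>2 \<le> 0" for t
  proof -
    have "load_payment (da_price c dd) lr (d l) (dd l)
        \<le> load_payment (da_price c dd) lr (d l) (dd l + t)"
      using assms by (simp add: competitive_equilibrium_def)
    then show ?thesis
      by (simp add: load_payment_def algebra_simps)
  qed
  then have "lr - da_price c dd = 0"
    by (rule linear_coeff_zero_if_nonpos)
  then show ?thesis by simp
qed

lemma competitive_total_profit:
  fixes c :: "'g::finite \<Rightarrow> real" and d :: "'l::finite \<Rightarrow> real"
  assumes c: "\<And>j. c j > 0" and ce: "competitive_equilibrium c d b dd \<beta> lr"
  defines "S \<equiv> \<Sum>j\<in>UNIV. inverse (c j)"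
  shows "total_gen_profit c b dd lr \<beta> = (sum d UNIV / S)\<^sup>2 * S / 2"
proof -
  have S: "S > 0"
    unfolding S_def using c by (rule sum_inverse_pos)
  have lr: "lr = da_price c dd"
    using ce by (rule competitive_prices_eq)
  \<comment> \<open>With equal prices, the day-ahead dispatch already has marginal cost equal to
    price, leaving nothing for real time.\<close>
  have g: "rt_dispatch b lr (\<beta> j) = 0" for j
    using competitive_dispatch[OF c ce, of j] lr by (simp add: da_dispatch_def field_simps)
  have "rt_demand d dd = 0"
    using ce by (simp add: competitive_equilibrium_def rt_clears_def g)
  then have lr': "lr = sum d UNIV / S"
    by (simp add: lr da_price_def S_def rt_demand_def sum_subtractf)
  have "gen_profit c b dd lr j (\<beta> j) = lr\<^sup>2 / 2 * inverse (c j)" for j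
    using c[of j]
    by (simp add: gen_profit_def g da_dispatch_def lr[symmetric] field_simps power2_eq_square)
  then have "total_gen_profit c b dd lr \<beta> = lr\<^sup>2 / 2 * S"
    by (simp only: total_gen_profit_def S_def sum_distrib_left)
  then show ?thesis
    by (simp add: lr')
qed

section \<open>Real-time subgame of the generators\<close>

lemma rt_nash_dispatch:
  fixes c :: "'g::finite \<Rightarrow> real" and d :: "'l::finite \<Rightarrow> real"
  assumes n: "CARD('g) > 1" and c: "c j > 0" and b: "b > 0"
    and ne: "rt_nash_equilibrium c d b dd \<beta>"
  defines "lr \<equiv> rt_price d b dd \<beta>"
  shows "rt_dispatch b lr (\<beta> j)
       = (lr - da_price c dd) * inverse (1 / (b * (real CARD('g) - 1)) + c j)"
proof -
  let ?n = "real CARD('g)" and ?g = "rt_dispatch b lr (\<beta> j)"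
  \<comment> \<open>Dispatch that the other generators together gain, and \<open>j\<close> loses,
    per unit of price increase.\<close>
  define a where "a = b * (?n - 1)"
  have a: "a > 0"
    using n b by (simp add: a_def)
  let ?A = "?g - a * lr + c j * a * (da_dispatch c dd j + ?g)"
  have "?A * t + (- a - c j / 2 * a\<^sup>2) * t\<^sup>2 \<le> 0" for t
  proof -
    \<comment> \<open>The deviation is parametrized by the price change \<open>t\<close> that it
      causes, so that \<open>?A\<close> is the marginal profit with respect to the price.\<close>
    let ?x = "\<beta> j + ?n * b * t"
    have price: "rt_price d b dd (\<beta>(j := ?x)) = lr + t"
      using b n unfolding lr_def rt_price_def sum_fun_upd_UNIV by (simp add: field_simps)
    have disp: "rt_dispatch b (lr + t) ?x = ?g - a * t"
      by (simp add: rt_dispatch_def a_def algebra_simps)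
    have "gen_profit c b dd (lr + t) j ?x \<le> gen_profit c b dd lr j (\<beta> j)"
      using ne price unfolding rt_nash_equilibrium_def lr_def by metis
    then show ?thesis
      unfolding gen_profit_def disp by (simp add: algebra_simps power2_eq_square)
  qed
  then have A: "?A = 0"
    by (rule linear_coeff_zero_if_nonpos)
  have "c j * da_dispatch c dd j = da_price c dd"
    using c by (simp add: da_dispatch_def)
  then have "c j * a * (da_dispatch c dd j + ?g) = a * da_price c dd + c j * a * ?g"
    by (metis distrib_left mult.assoc mult.commute)
  then have "?g + c j * a * ?g = a * lr - a * da_price c dd"
    using A by linarith
  then have "?g * (1 + c j * a) = a * (lr - da_price c dd)"
    by (simp add: algebra_simps)
  moreover have "1 + c j * a > 0"
    using a c by (simp add: add_pos_pos)
  moreover have "1 / a + c j = (1 + c j * a) / a"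
    using a by (simp add: field_simps)
  ultimately show ?thesis
    using a by (simp add: a_def[symmetric] field_simps)
qed

text \<open>Summing the equilibrium dispatches and using market clearing gives real-time demand as
  \<open>T\<close> times the price spread.\<close>

lemma rt_nash_price:
  fixes c :: "'g::finite \<Rightarrow> real" and d :: "'l::finite \<Rightarrow> real"
  assumes n: "CARD('g) > 1" and c: "\<And>j. c j > 0" and b: "b > 0"
    and ne: "rt_nash_equilibrium c d b dd \<beta>"
  defines "T \<equiv> \<Sum>j\<in>UNIV. inverse (1 / (b * (real CARD('g) - 1)) + c j)"
  shows "rt_price d b dd \<beta> = da_price c dd + rt_demand d dd / T"
proof -
  let ?lr = "rt_price d b dd \<beta>"
  have T: "T > 0"
    unfolding T_def using n b c by (intro sum_inverse_pos add_pos_pos) simp_all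
  have "rt_clears d b dd \<beta> ?lr"
    using b by (simp add: rt_clears_iff)
  then have "rt_demand d dd = (?lr - da_price c dd) * T"
    by (simp add: rt_clears_def rt_nash_dispatch[OF n c b ne] T_def sum_distrib_left)
  then show ?thesis
    using T by simp
qed

section \<open>Day-ahead game of the loads\<close>

lemma load_payment_subgame:
  fixes c :: "'g::finite \<Rightarrow> real" and d :: "'l::finite \<Rightarrow> real"
  assumes n: "CARD('g) > 1" and c: "\<And>j. c j > 0" and b: "b > 0"
    and ne: "rt_nash_equilibrium c d b dd \<beta>"
  defines "T \<equiv> \<Sum>j\<in>UNIV. inverse (1 / (b * (real CARD('g) - 1)) + c j)"
  shows "load_payment (da_price c dd) (rt_price d b dd \<beta>) dl x
       = da_price c dd * dl + rt_demand d dd / T * (dl - x)"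
  unfolding load_payment_def rt_nash_price[OF n c b ne, folded T_def]
  by (simp add: algebra_simps)

lemma stackelberg_rt_demand:
  fixes c :: "'g::finite \<Rightarrow> real" and d :: "'l::finite \<Rightarrow> real"
  assumes n: "CARD('g) > 1" and c: "\<And>j. c j > 0" and b: "b > 0"
    and se: "stackelberg_nash_equilibrium c d b dd \<sigma>"
  defines "S \<equiv> \<Sum>j\<in>UNIV. inverse (c j)"
    and "T \<equiv> \<Sum>j\<in>UNIV. inverse (1 / (b * (real CARD('g) - 1)) + c j)"
  shows "rt_demand d dd / T * (real CARD('l) + 1) = sum d UNIV / S"
proof -
  have S: "S > 0"
    unfolding S_def using c by (rule sum_inverse_pos)
  have T: "T > 0"
    unfolding T_def using n b c by (intro sum_inverse_pos add_pos_pos) simp_all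
  \<comment> \<open>Equilibrium off the path matters here: a deviating load faces the bids
    \<open>\<sigma>\<close> assigns to the deviated profile.\<close>
  have ne: "rt_nash_equilibrium c d b dd' (\<sigma> dd')" for dd'
    using se by (simp add: stackelberg_nash_equilibrium_def)
  note pay = load_payment_subgame[OF n c b ne, folded T_def]
  let ?R = "rt_demand d dd"
  have foc: "d l / S = (d l - dd l) / T + ?R / T" for l
  proof -
    \<comment> \<open>Marginal saving from shifting demand to the day-ahead market: less is bought
      at the spread \<open>?R / T\<close>, and the spread itself falls, but the higher day-ahead
      price applies to all of \<open>d l\<close>.\<close>
    let ?A = "(d l - dd l) / T + ?R / T - d l / S"
    have "?A * t + (- 1 / T) * t\<^sup>2 \<le> 0" for t
    proof -
      have da: "da_price c (dd(l := dd l + t)) = da_price c dd + t / S"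
        by (simp only: da_price_def sum_fun_upd_UNIV S_def add_divide_distrib add_diff_cancel_left')
      have "rt_demand d (dd(l := dd l + t)) = ?R - t"
        by (simp only: rt_demand_def sum_subtractf sum_fun_upd_UNIV)
      note eqs = da this
      have "load_payment (da_price c dd) (rt_price d b dd (\<sigma> dd)) (d l) (dd l)
          \<le> load_payment (da_price c (dd(l := dd l + t)))
              (rt_price d b (dd(l := dd l + t)) (\<sigma> (dd(l := dd l + t)))) (d l) (dd l + t)"
        using se unfolding stackelberg_nash_equilibrium_def by blast
      then have "da_price c dd * d l + ?R / T * (d l - dd l)
          \<le> (da_price c dd + t / S) * d l + (?R - t) / T * (d l - (dd l + t))"
        unfolding pay unfolding eqs .
      moreover have "?A * t + (- 1 / T) * t\<^sup>2
          = (da_price c dd * d l + ?R / T * (d l - dd l))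
            - ((da_price c dd + t / S) * d l + (?R - t) / T * (d l - (dd l + t)))"
        using S T by (simp add: field_simps power2_eq_square)
      ultimately show ?thesis by linarith
    qed
    then have "?A = 0"
      by (rule linear_coeff_zero_if_nonpos)
    then show ?thesis by simp
  qed
  \<comment> \<open>The terms \<open>d l - dd l\<close> add up to \<open>?R\<close>, so
    \<open>?R / T\<close> occurs once more than there are loads.\<close>
  have "sum d UNIV / S = (\<Sum>l\<in>UNIV. (d l - dd l) / T + ?R / T)"
    by (simp add: sum_divide_distrib foc)
  also have "\<dots> = ?R / T + real CARD('l) * (?R / T)"
    by (simp add: sum.distrib rt_demand_def sum_divide_distrib[symmetric])
  finally show ?thesis
    by (simp add: algebra_simps add_divide_distrib)
qed

section \<open>Comparison of total profits\<close>

theorem corollary3: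
  fixes c :: "'g::finite \<Rightarrow> real" and d :: "'l::finite \<Rightarrow> real" and b :: real
    and ddC ddN :: "'l \<Rightarrow> real" and \<beta>C :: "'g \<Rightarrow> real" and lrC :: real
    and \<sigma>N :: "('l \<Rightarrow> real) \<Rightarrow> ('g \<Rightarrow> real)"
  assumes "CARD('g) > 1"
    and "\<And>j. c j > 0"
    and "\<And>l. d l > 0"
    and "b > 0"
    and "competitive_equilibrium c d b ddC \<beta>C lrC"
    and "stackelberg_nash_equilibrium c d b ddN \<sigma>N"
  shows "total_gen_profit c b ddN (rt_price d b ddN (\<sigma>N ddN)) (\<sigma>N ddN)
         < total_gen_profit c b ddC lrC \<beta>C"
proof -
  note n = assms(1) and c = assms(2) and b = assms(4)
  define C where "C j = 1 / (b * (real CARD('g) - 1)) + c j" for j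
  define S where "S = (\<Sum>j\<in>UNIV. inverse (c j))"
  define T where "T = (\<Sum>j\<in>UNIV. inverse (C j))"
  define E where "E = sum d UNIV / S"
  define u where "u = rt_demand d ddN / T"
  let ?p = "da_price c ddN" and ?lr = "rt_price d b ddN (\<sigma>N ddN)" and ?L = "real CARD('l)"
  have C: "C j > c j" for j
    using n b by (simp add: C_def)
  then have C0: "C j > 0" for j
    using c less_trans by blast
  have S: "S > 0"
    unfolding S_def using c by (rule sum_inverse_pos)
  have T: "T > 0"
    unfolding T_def using C0 by (rule sum_inverse_pos)
  have "T \<le> S"
    unfolding T_def S_def by (intro sum_mono le_imp_inverse_le less_imp_le[OF C] c)
  have "sum d UNIV > 0"
    by (rule sum_pos) (simp_all add: assms(3))
  then have E: "E > 0"
    using S by (simp add: E_def)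
  have uE: "E = u * (?L + 1)"
    using stackelberg_rt_demand[OF n c b assms(6)]
    by (simp add: E_def S_def u_def T_def C_def)
  then have u: "u > 0"
    using E by (simp add: zero_less_mult_iff)
  have ne: "rt_nash_equilibrium c d b ddN (\<sigma>N ddN)"
    using assms(6) by (simp add: stackelberg_nash_equilibrium_def)
  have lr: "?lr = ?p + u"
    using rt_nash_price[OF n c b ne] by (simp add: u_def T_def C_def)
  have g: "rt_dispatch b ?lr (\<sigma>N ddN j) = u * inverse (C j)" for j
    using rt_nash_dispatch[OF n c b ne, of j] by (simp add: lr C_def)
  have "rt_demand d ddN = T * u"
    using T by (simp add: u_def)
  then have "(\<Sum>l\<in>UNIV. ddN l) = sum d UNIV - T * u"
    by (simp add: rt_demand_def sum_subtractf)
  then have p: "?p = E - T * u / S"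
    by (simp add: da_price_def E_def S_def diff_divide_distrib)
  \<comment> \<open>Since \<open>c j * ?p / c j = ?p\<close>, the cross term of the cost cancels the
    revenue \<open>?p\<close> per unit of real-time dispatch. Dropping the remaining quadratic
    real-time cost gives an upper bound.\<close>
  have "gen_profit c b ddN ?lr j (\<sigma>N ddN j) \<le> ?p\<^sup>2 / 2 * inverse (c j) + u\<^sup>2 * inverse (C j)" for j
  proof -
    have "gen_profit c b ddN ?lr j (\<sigma>N ddN j)
        = ?p\<^sup>2 / 2 * inverse (c j) + u\<^sup>2 * inverse (C j) - c j / 2 * (u * inverse (C j))\<^sup>2"
      unfolding gen_profit_def g unfolding lr da_dispatch_def
      using c[of j] C0[of j] by (simp add: field_simps power2_eq_square)
    moreover have "c j / 2 * (u * inverse (C j))\<^sup>2 \<ge> 0"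
      using c[of j] by simp
    ultimately show ?thesis by linarith
  qed
  then have "total_gen_profit c b ddN ?lr (\<sigma>N ddN)
      \<le> (\<Sum>j\<in>UNIV. ?p\<^sup>2 / 2 * inverse (c j) + u\<^sup>2 * inverse (C j))"
    unfolding total_gen_profit_def by (rule sum_mono)
  also have "\<dots> = ?p\<^sup>2 / 2 * S + u\<^sup>2 * T"
    by (simp add: sum.distrib S_def T_def sum_distrib_left)
  \<comment> \<open>The competitive profit is split off; what is subtracted is positive once its
    bracket is.\<close>
  also have "\<dots> = E\<^sup>2 * S / 2 - T * u * (E - T / S * u / 2 - u)"
    unfolding p using S by (simp add: field_simps power2_eq_square)
  also have "\<dots> < E\<^sup>2 * S / 2"
  proof -
    \<comment> \<open>One load already gives \<open>E \<ge> 2 * u\<close>; with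
      \<open>T \<le> S\<close> the bracket is at least \<open>u / 2\<close>.\<close>
    have "?L \<ge> 1"
      by (simp add: Suc_le_eq)
    then have "u * 2 \<le> E"
      unfolding uE using u by (intro mult_left_mono) simp_all
    moreover have "T / S * u / 2 \<le> u / 2"
      using \<open>T \<le> S\<close> S u by (simp add: pos_divide_le_eq mult.commute)
    ultimately have "E - T / S * u / 2 - u > 0"
      using u by linarith
    then have "T * u * (E - T / S * u / 2 - u) > 0"
      using T u by simp
    then show ?thesis by linarith
  qed
  also have "E\<^sup>2 * S / 2 = total_gen_profit c b ddC lrC \<beta>C"
    using competitive_total_profit[OF c assms(5)] by (simp add: E_def S_def)
  finally show ?thesis .
qed

end
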